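(* There exist consistent propositional formulae $R$ and $K_1,\ldots,K_m$ such that $R$ is the disjunction of some of the maxsets of $K_1,\ldots,K_m$ but $R$ is not obtainable by priority base merging from $K_1,\ldots,K_m$.
   Context: A maxset of $K_1,\ldots,K_m$ is a maximal (under inclusion) consistent subset $M\subseteq\{K_1,\ldots,K_m\}$; in a disjunction, a maxset stands for the conjunction of its formulae. A priority ordering is an ordered partition $P(1),P(2),\ldots,P(k)$ of $\{K_1,\ldots,K_m\}$ into nonempty classes. For $L,N\subseteq\{K_1,\ldots,K_m\}$, $L<N$ iff there is $i$ such that $P(j)\cap L=P(j)\cap N$ for all $j<i$ and $P(i)\cap L\supsetneq P(i)\cap N$. The result of (priority base) merging with $P$ is the disjunction of all maxsets $M$ that are minimal, i.e. such that no maxset $N$ satisfies $N<M$. $R$ is obtainable from $K_1,\ldots,K_m$ if it is equivalent to the result of merging with some priority ordering. *)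

theory Defs
  imports Main "HOL-Library.Disjoint_Sets"
begin

datatype 'a form =
    Atom 'a
  | Top
  | Bot
  | Neg "'a form"
  | And "'a form" "'a form"
  | Or "'a form" "'a form"
  | Imp "'a form" "'a form"
  | Iff "'a form" "'a form"

primrec eval :: "('a \<Rightarrow> bool) \<Rightarrow> 'a form \<Rightarrow> bool" where
  "eval v (Atom a) = v a"
| "eval v Top = True"
| "eval v Bot = False"
| "eval v (Neg F) = (\<not> eval v F)"
| "eval v (And F G) = (eval v F \<and> eval v G)"
| "eval v (Or F G) = (eval v F \<or> eval v G)"
| "eval v (Imp F G) = (eval v F \<longrightarrow> eval v G)"
| "eval v (Iff F G) = (eval v F \<longleftrightarrow> eval v G)"

definition consistent :: "'a form set \<Rightarrow> bool" where
  "consistent M \<longleftrightarrow> (\<exists>v. \<forall>F\<in>M. eval v F)"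

definition equivalent :: "'a form \<Rightarrow> 'a form \<Rightarrow> bool" where
  "equivalent F G \<longleftrightarrow> (\<forall>v. eval v F = eval v G)"

definition Conj :: "'a form list \<Rightarrow> 'a form" where
  "Conj Fs = foldr And Fs Top"

definition Disj :: "'a form list \<Rightarrow> 'a form" where
  "Disj Fs = foldr Or Fs Bot"

lemma eval_Conj [simp]: "eval v (Conj Fs) \<longleftrightarrow> (\<forall>F\<in>set Fs. eval v F)"
  by (induction Fs) (auto simp: Conj_def)

lemma eval_Disj [simp]: "eval v (Disj Fs) \<longleftrightarrow> (\<exists>F\<in>set Fs. eval v F)"
  by (induction Fs) (auto simp: Disj_def)

text \<open>The list \<open>Ks\<close> stands for K1, ..., Km. It also fixes the order in which the members of a
  set \<open>M \<subseteq> set Ks\<close> are conjoined and the members of a family \<open>S \<subseteq> Pow (set Ks)\<close> are disjoined.\<close>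

definition disj_of_sets :: "'a form list \<Rightarrow> 'a form set set \<Rightarrow> 'a form" where
  "disj_of_sets Ks S = Disj (map Conj (filter (\<lambda>Ms. set Ms \<in> S) (subseqs Ks)))"

lemma eval_disj_of_sets:
  assumes "S \<subseteq> Pow (set Ks)"
  shows "eval v (disj_of_sets Ks S) \<longleftrightarrow> (\<exists>M\<in>S. \<forall>K\<in>M. eval v K)"
proof -
  have "eval v (disj_of_sets Ks S) \<longleftrightarrow>
      (\<exists>M \<in> set ` set (subseqs Ks). M \<in> S \<and> (\<forall>K\<in>M. eval v K))"
    by (auto simp: disj_of_sets_def)
  also have "\<dots> \<longleftrightarrow> (\<exists>M\<in>S. \<forall>K\<in>M. eval v K)"
    unfolding subseqs_powset using assms by blast
  finally show ?thesis .
qed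

definition maxset :: "'a form set \<Rightarrow> 'a form set \<Rightarrow> bool" where
  "maxset K M \<longleftrightarrow> M \<subseteq> K \<and> consistent M \<and> (\<forall>N. N \<subseteq> K \<and> consistent N \<and> M \<subseteq> N \<longrightarrow> N = M)"

text \<open>The classes of a priority ordering are indexed from 0: \<open>P ! 0\<close> is the class of highest priority.
  Since classes are nonempty, \<open>distinct P\<close> together with \<open>partition_on\<close> makes
  classes at different positions disjoint.\<close>

definition priority_ordering :: "'a form set \<Rightarrow> 'a form set list \<Rightarrow> bool" where
  "priority_ordering K P \<longleftrightarrow> distinct P \<and> partition_on K (set P)"

definition prio_less :: "'a form set list \<Rightarrow> 'a form set \<Rightarrow> 'a form set \<Rightarrow> bool" where
  "prio_less P L N \<longleftrightarrow>
     (\<exists>i<length P. (\<forall>j<i. P ! j \<inter> L = P ! j \<inter> N) \<and> P ! i \<inter> N \<subset> P ! i \<inter> L)"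

definition minimal_maxset :: "'a form set \<Rightarrow> 'a form set list \<Rightarrow> 'a form set \<Rightarrow> bool" where
  "minimal_maxset K P M \<longleftrightarrow> maxset K M \<and> (\<nexists>N. maxset K N \<and> prio_less P N M)"

definition merge :: "'a form list \<Rightarrow> 'a form set list \<Rightarrow> 'a form" where
  "merge Ks P = disj_of_sets Ks {M. minimal_maxset (set Ks) P M}"

definition obtainable :: "'a form \<Rightarrow> 'a form list \<Rightarrow> bool" where
  "obtainable R Ks \<longleftrightarrow> (\<exists>P. priority_ordering (set Ks) P \<and> equivalent R (merge Ks P))"

end

theory Submission imports Defs begin

text \<open>Take the formulae \<open>a\<close>, \<open>\<not>a\<close>, \<open>b\<close>, \<open>\<not>b\<close>, whose maxsets choose one literal of each of the two atoms,
  and let \<open>R\<close> be the disjunction of \<open>{a, b}\<close> and \<open>{\<not>a, \<not>b}\<close>. If \<open>a\<close> and \<open>\<not>a\<close> had different priority,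
  the preferred one could be exchanged for the other in one of these two maxsets, which would then
  not be minimal; likewise for \<open>b\<close> and \<open>\<not>b\<close>. But when both pairs share a class, no maxset beats
  another one, so \<open>{a, \<not>b}\<close> is selected as well.\<close>

text \<open>Carrying the sign as a Boolean lets \<open>lit (v p) p\<close> name the literal of
  \<open>p\<close> that is true under \<open>v\<close>, and lets \<open>\<not> z\<close> name the
  opposite sign.\<close>

definition lit :: "bool \<Rightarrow> 'a \<Rightarrow> 'a form" where
  "lit x p = (if x then Atom p else Neg (Atom p))"

lemma eval_lit [simp]: "eval v (lit x p) \<longleftrightarrow> v p = x"
  by (simp add: lit_def)

lemma lit_eq_iff [simp]: "lit x p = lit y q \<longleftrightarrow> x = y \<and> p = q"
  by (auto simp: lit_def)

text \<open>A valuation makes exactly one literal of each atom true, so a consistent set lies inside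
  such a pair; as \<open>p\<close> and \<open>q\<close> are distinct, all four sign choices are
  satisfiable.\<close>

lemma maxset_two_literals_iff:
  assumes "p \<noteq> q"
  shows "maxset {lit True p, lit False p, lit True q, lit False q} M
    \<longleftrightarrow> (\<exists>x y. M = {lit x p, lit y q})"
    (is "maxset ?K M \<longleftrightarrow> _")
proof
  assume M: "maxset ?K M"
  then obtain v where v: "\<forall>F\<in>M. eval v F" and sub: "M \<subseteq> ?K"
    by (auto simp: maxset_def consistent_def)
  let ?N = "{lit (v p) p, lit (v q) q}"
  have "F \<in> ?N" if "F \<in> M" for F
  proof -
    have "F \<in> ?K" "eval v F"
      using that sub v by auto
    then show ?thesis
      by auto
  qed
  then have "M \<subseteq> ?N"
    by blast
  moreover have "?N \<subseteq> ?K" "consistent ?N"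
    by (cases "v p"; cases "v q"; simp) (auto simp: consistent_def)
  ultimately have "M = ?N"
    using M unfolding maxset_def by blast
  then show "\<exists>x y. M = {lit x p, lit y q}"
    by blast
next
  assume "\<exists>x y. M = {lit x p, lit y q}"
  then obtain x y where M: "M = {lit x p, lit y q}"
    by blast
  have "consistent M"
    unfolding consistent_def using assms
    by (intro exI[of _ "\<lambda>r. if r = p then x else y"]) (auto simp: M)
  moreover have "N = M" if "N \<subseteq> ?K" "consistent N" "M \<subseteq> N" for N
  proof -
    obtain v where v: "\<forall>F\<in>N. eval v F"
      using \<open>consistent N\<close> by (auto simp: consistent_def)
    then have "v p = x" "v q = y"
      using \<open>M \<subseteq> N\<close> by (auto simp: M)
    have "F \<in> M" if "F \<in> N" for F
    proof -
      have "F \<in> ?K" "eval v F"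
        using that v \<open>N \<subseteq> ?K\<close> by auto
      then show ?thesis
        using \<open>v p = x\<close> \<open>v q = y\<close> by (auto simp: M)
    qed
    then show ?thesis
      using \<open>M \<subseteq> N\<close> by blast
  qed
  moreover have "M \<subseteq> ?K"
    by (cases x; cases y) (auto simp: M)
  ultimately show "maxset ?K M"
    unfolding maxset_def by blast
qed

text \<open>Turns the partition into a rank function, so that priorities can be compared as numbers.
  Covering gives a class for each formula; disjointness of classes at different positions makes it
  unique.\<close>

lemma priority_ordering_index:
  assumes "priority_ordering K P"
  obtains idx where "\<And>F. F \<in> K \<Longrightarrow> idx F < length P"
    and "\<And>F j. F \<in> K \<Longrightarrow> j < length P \<Longrightarrow> F \<in> P ! j \<longleftrightarrow> j = idx F"
proof -
  have part: "partition_on K (set P)" and dist: "distinct P"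
    using assms by (auto simp: priority_ordering_def)
  have "\<exists>i<length P. \<forall>j<length P. F \<in> P ! j \<longleftrightarrow> j = i" if F: "F \<in> K" for F
  proof -
    obtain i where i: "i < length P" "F \<in> P ! i"
      using F partition_onD1[OF part] by (auto simp: in_set_conv_nth)
    have "j = i" if j: "j < length P" "F \<in> P ! j" for j
    proof (rule ccontr)
      assume "j \<noteq> i"
      then have "P ! j \<inter> P ! i = {}"
        using i j dist disjointD[OF partition_onD2[OF part], of "P ! j" "P ! i"]
        by (simp add: nth_eq_iff_index_eq)
      then show False
        using i j by blast
    qed
    then show ?thesis
      using i by blast
  qed
  then show thesis
    using that by metis
qed

text \<open>Before class \<open>i\<close> neither \<open>F\<close> nor \<open>G\<close> occurs, so
  both sets agree there; in class \<open>i\<close> the first set gains \<open>F\<close> while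
  \<open>G\<close> contributes nothing.\<close>

lemma prio_less_exchange:
  assumes "i < length P" "F \<in> P ! i" "\<And>j. j \<le> i \<Longrightarrow> G \<notin> P ! j"
    and "\<And>j. j < i \<Longrightarrow> F \<notin> P ! j" "F \<notin> C"
  shows "prio_less P (insert F C) (insert G C)"
  unfolding prio_less_def using assms by (intro exI[of _ i]) auto

lemma minimal_maxsets_not_diagonal:
  assumes "p \<noteq> q"
    and K: "K = {lit True p, lit False p, lit True q, lit False q}"
    and P: "priority_ordering K P"
    and diag: "\<And>x. minimal_maxset K P {lit x p, lit x q}"
  shows "minimal_maxset K P {lit x p, lit y q}"
proof -
  have maxset_iff: "maxset K M \<longleftrightarrow> (\<exists>x y. M = {lit x p, lit y q})" for M
    unfolding K using \<open>p \<noteq> q\<close> by (rule maxset_two_literals_iff)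
  have mem: "lit z p \<in> K" "lit z q \<in> K" for z
    by (cases z; simp add: K)+
  obtain idx where len: "\<And>F. F \<in> K \<Longrightarrow> idx F < length P"
    and idx: "\<And>F j. F \<in> K \<Longrightarrow> j < length P \<Longrightarrow> F \<in> P ! j \<longleftrightarrow> j = idx F"
    using priority_ordering_index[OF P] by blast
  have exchange: "prio_less P (insert F C) (insert G C)"
    if "F \<in> K" "G \<in> K" "idx F < idx G" "F \<notin> C" for F G C
    using that len[of F] by (intro prio_less_exchange[of "idx F"]) (auto simp: idx)
  have not_less: "\<not> prio_less P {lit x p, lit y q} {lit z p, lit z q}" for x y z
    using diag[of z] maxset_iff unfolding minimal_maxset_def by blast
  \<comment> \<open>Otherwise exchanging the \<open>p\<close>-literal of the diagonal maxset of sign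
    \<open>\<not> z\<close> yields a maxset that beats it.\<close>
  have "\<not> idx (lit z p) < idx (lit (\<not> z) p)" for z
    using exchange[of "lit z p" "lit (\<not> z) p" "{lit (\<not> z) q}"] not_less[of z "\<not> z" "\<not> z"]
      mem \<open>p \<noteq> q\<close> by auto
  from this[of True] this[of False] have idx_p: "idx (lit z p) = idx (lit w p)" for z w
    by (cases z; cases w) auto
  have "\<not> idx (lit z q) < idx (lit (\<not> z) q)" for z
    using exchange[of "lit z q" "lit (\<not> z) q" "{lit (\<not> z) p}"] not_less[of "\<not> z" z "\<not> z"]
      mem \<open>p \<noteq> q\<close> by (auto simp: insert_commute)
  from this[of True] this[of False] have idx_q: "idx (lit z q) = idx (lit w q)" for z w
    by (cases z; cases w) auto
  have "\<not> prio_less P {lit z p, lit w q} {lit x p, lit y q}" for z w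
  proof
    assume "prio_less P {lit z p, lit w q} {lit x p, lit y q}"
    then obtain i where i: "i < length P"
      and less: "P ! i \<inter> {lit x p, lit y q} \<subset> P ! i \<inter> {lit z p, lit w q}"
      by (auto simp: prio_less_def)
    \<comment> \<open>Both literals of an atom share a class, so in class \<open>i\<close> the two
      maxsets have literals of the same atoms. The inclusion in \<open>less\<close> forces their
      signs to agree, which leaves no room for strictness.\<close>
    have "lit x p \<in> P ! i \<longleftrightarrow> lit z p \<in> P ! i" "lit y q \<in> P ! i \<longleftrightarrow> lit w q \<in> P ! i"
      using i idx mem idx_p[of x z] idx_q[of y w] by auto
    moreover have "x = z" if "lit x p \<in> P ! i"
    proof -
      have "lit x p \<in> {lit z p, lit w q}"
        using less that by blast
      then show ?thesis
        using \<open>p \<noteq> q\<close> by simp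
    qed
    moreover have "y = w" if "lit y q \<in> P ! i"
    proof -
      have "lit y q \<in> {lit z p, lit w q}"
        using less that by blast
      then show ?thesis
        using \<open>p \<noteq> q\<close> by simp
    qed
    ultimately have "P ! i \<inter> {lit z p, lit w q} \<subseteq> P ! i \<inter> {lit x p, lit y q}"
      by blast
    then show False
      using less by blast
  qed
  then show ?thesis
    unfolding minimal_maxset_def maxset_iff by blast
qed

theorem corollary1:
  "\<exists>(R :: nat form) Ks.
     Ks \<noteq> [] \<and> distinct Ks \<and>
     consistent {R} \<and> (\<forall>K\<in>set Ks. consistent {K}) \<and>
     (\<exists>S. S \<subseteq> {M. maxset (set Ks) M} \<and> R = disj_of_sets Ks S) \<and>
     \<not> obtainable R Ks"
proof -
  define Ks :: "nat form list" where "Ks = [lit True 0, lit False 0, lit True 1, lit False 1]"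
  define S :: "nat form set set" where "S = range (\<lambda>x. {lit x 0, lit x 1})"
  have set_Ks: "set Ks = {lit True 0, lit False 0, lit True 1, lit False 1}"
    by (simp add: Ks_def)
  have maxset_iff: "maxset (set Ks) M \<longleftrightarrow> (\<exists>x y. M = {lit x 0, lit y 1})" for M
    unfolding set_Ks by (rule maxset_two_literals_iff) simp
  have S: "S \<subseteq> {M. maxset (set Ks) M}"
    using maxset_iff by (auto simp: S_def)
  then have "S \<subseteq> Pow (set Ks)"
    by (auto simp: maxset_def)
  then have eval_R: "eval v (disj_of_sets Ks S) \<longleftrightarrow> v 0 = v 1" for v :: "nat \<Rightarrow> bool"
    by (auto simp: eval_disj_of_sets S_def)
  have "\<not> obtainable (disj_of_sets Ks S) Ks"
  proof
    assume "obtainable (disj_of_sets Ks S) Ks"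
    then obtain P where P: "priority_ordering (set Ks) P"
      and eq: "\<And>v. eval v (disj_of_sets Ks S) = eval v (merge Ks P)"
      by (auto simp: obtainable_def equivalent_def)
    have "{M. minimal_maxset (set Ks) P M} \<subseteq> Pow (set Ks)"
      by (auto simp: minimal_maxset_def maxset_def)
    then have eval_merge: "eval v (merge Ks P) \<longleftrightarrow>
        (\<exists>M. minimal_maxset (set Ks) P M \<and> (\<forall>K\<in>M. eval v K))" for v
      by (simp add: merge_def eval_disj_of_sets)
    \<comment> \<open>A valuation satisfies exactly one maxset, that of its true literals. Hence the
      truth value of the merge under \<open>v\<close> tells whether this maxset is minimal, and
      equivalence with R determines the selected family.\<close>
    have minimal: "minimal_maxset (set Ks) P {lit (v 0) 0, lit (v 1) 1} \<longleftrightarrow> v 0 = v 1" for v :: "nat \<Rightarrow> bool"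
      unfolding eval_R[symmetric] eq eval_merge
    proof
      assume "\<exists>M. minimal_maxset (set Ks) P M \<and> (\<forall>K\<in>M. eval v K)"
      then obtain M where M: "minimal_maxset (set Ks) P M" "\<forall>K\<in>M. eval v K"
        by blast
      then obtain x y where "M = {lit x 0, lit y 1}"
        using maxset_iff by (auto simp: minimal_maxset_def)
      then show "minimal_maxset (set Ks) P {lit (v 0) 0, lit (v 1) 1}"
        using M by simp
    next
      assume "minimal_maxset (set Ks) P {lit (v 0) 0, lit (v 1) 1}"
      then show "\<exists>M. minimal_maxset (set Ks) P M \<and> (\<forall>K\<in>M. eval v K)"
        by (intro exI[of _ "{lit (v 0) 0, lit (v 1) 1}"]) simp
    qed
    have "minimal_maxset (set Ks) P {lit x 0, lit x 1}" for x
      using minimal[of "\<lambda>_. x"] by simp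
    then have "minimal_maxset (set Ks) P {lit True 0, lit False 1}"
      using minimal_maxsets_not_diagonal[OF _ set_Ks P, of True False] by simp
    then show False
      \<comment> \<open>This valuation makes atom 0 true and atom 1 false, so R fails under it
        although its maxset was just shown to be minimal.\<close>
      using minimal[of "\<lambda>n. n = 0"] by simp
  qed
  moreover have "consistent {disj_of_sets Ks S}"
    by (auto simp: consistent_def eval_R)
  moreover have "\<forall>K\<in>set Ks. consistent {K}"
    by (auto simp: set_Ks consistent_def)
  moreover have "Ks \<noteq> []" "distinct Ks"
    by (simp_all add: Ks_def)
  ultimately show ?thesis
    using S by blast
qed

end
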